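(* (1) There exist integers $N_n\ge 2$ and nonempty sets $B_n\subset\{0,1,\dots,N_n-1\}$ $(n\ge 1)$ such that, for the Cantor-Moran measure $\mu(N_n,B_n)$, the associated sequence of measures $\{\nu_{>n}\}$ does not have any equi-positive subsequence. (2) There exist integers $N_n\ge 2$ and nonempty sets $B_n\subset\{0,1,\dots,N_n-1\}$ $(n\ge 1)$ such that, for the Cantor-Moran measure $\mu(N_n,B_n)$, the associated sequence of measures $\{\nu_{>n}\}$, supported inside $[0,1]$, converges weakly to $\rho=\frac12(\delta_0+\delta_1)$ and $\{\widehat{\nu_{>n}}\}$ converges uniformly to $\widehat{\rho}$ on the non-compact set $\frac12+\mathbb{Z}$.
   Context: For a finite nonempty set $A\subset\mathbb{R}$, $\delta_A=\frac{1}{\#A}\sum_{a\in A}\delta_a$, where $\delta_a$ is the Dirac measure at $a$. For integers $N_n\ge2$ and nonempty $B_n\subset\{0,1,\dots,N_n-1\}$, the Cantor-Moran measure is $\mu(N_n,B_n)=\delta_{\frac{1}{N_1}B_1}\ast\delta_{\frac{1}{N_1N_2}B_2}\ast\cdots$ (weak limit of the finite convolutions). Write $\mu=\mu_n\ast\mu_{>n}$, where $\mu_n$ is the convolution of the first $n$ discrete measures and $\mu_{>n}$ the convolution of the remaining ones, and let $\nu_{>n}(E)=\mu_{>n}\big((N_1\cdots N_n)^{-1}E\big)$; thus $\nu_{>n}=\delta_{\frac{1}{N_{n+1}}B_{n+1}}\ast\delta_{\frac{1}{N_{n+1}N_{n+2}}B_{n+2}}\ast\cdots$. The Fourier transform is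 $\widehat{\mu}(\xi)=\int e^{-2\pi i\xi x}\,d\mu(x)$. A collection $\Phi$ of Borel probability measures on $[0,1]$ is equi-positive if there exists $\epsilon_0>0$ such that for all $x\in[0,1]$ and all $\nu\in\Phi$ there is $k_{x,\nu}\in\mathbb{Z}$ with $|\widehat{\nu}(x+k_{x,\nu})|\ge\epsilon_0$. *)

theory Defs
  imports "HOL-Probability.Probability"
begin

section \<open>Discrete uniform measures and infinite convolutions\<close>

text \<open>The measure \<open>\<delta>\<^sub>A\<close>, as a Borel measure on the line.\<close>

definition unif_dirac :: "real set \<Rightarrow> real measure" where
  "unif_dirac A = distr (measure_pmf (pmf_of_set A)) borel (\<lambda>x. x)"

primrec fin_conv :: "(nat \<Rightarrow> real measure) \<Rightarrow> nat \<Rightarrow> real measure" where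
  "fin_conv D 0 = return borel 0"
| "fin_conv D (Suc m) = (fin_conv D m \<star> D m)"

text \<open>The weak limit of the finite convolutions \<open>D 0 \<star> \<dots> \<star> D (m - 1)\<close>. It is unique if it
  exists (lemma \<open>inf_conv_eqI\<close>), and for Cantor-Moran factors it always exists
  (lemma \<open>weak_conv_moran_tail\<close>).\<close>

definition inf_conv :: "(nat \<Rightarrow> real measure) \<Rightarrow> real measure" where
  "inf_conv D = (THE M. real_distribution M \<and> weak_conv_m (fin_conv D) M)"

section \<open>Cantor-Moran measures\<close>

text \<open>Sequences are indexed from 1; the values \<open>N 0\<close> and \<open>B 0\<close> are never used.\<close>

definition moran_data :: "(nat \<Rightarrow> nat) \<Rightarrow> (nat \<Rightarrow> nat set) \<Rightarrow> bool" where
  "moran_data N B \<longleftrightarrow> (\<forall>n\<ge>1. N n \<ge> 2 \<and> B n \<noteq> {} \<and> B n \<subseteq> {0..N n - 1})"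

definition moran_factor :: "(nat \<Rightarrow> nat) \<Rightarrow> (nat \<Rightarrow> nat set) \<Rightarrow> nat \<Rightarrow> real measure" where
  "moran_factor N B k = unif_dirac ((\<lambda>b. real b / real (\<Prod>i=1..k. N i)) ` B k)"

definition cantor_moran :: "(nat \<Rightarrow> nat) \<Rightarrow> (nat \<Rightarrow> nat set) \<Rightarrow> real measure" where
  "cantor_moran N B = inf_conv (\<lambda>k. moran_factor N B (Suc k))"

text \<open>\<open>\<mu>\<^sub>n\<close> and \<open>\<mu>\<^sub>>\<^sub>n\<close>; lemma \<open>cantor_moran_split\<close> confirms \<open>\<mu> = \<mu>\<^sub>n \<star> \<mu>\<^sub>>\<^sub>n\<close>.\<close>

definition moran_head :: "(nat \<Rightarrow> nat) \<Rightarrow> (nat \<Rightarrow> nat set) \<Rightarrow> nat \<Rightarrow> real measure" where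
  "moran_head N B n = fin_conv (\<lambda>k. moran_factor N B (Suc k)) n"

definition moran_tail :: "(nat \<Rightarrow> nat) \<Rightarrow> (nat \<Rightarrow> nat set) \<Rightarrow> nat \<Rightarrow> real measure" where
  "moran_tail N B n = inf_conv (\<lambda>k. moran_factor N B (Suc (n + k)))"

text \<open>\<open>\<nu>\<^sub>>\<^sub>n(E) = \<mu>\<^sub>>\<^sub>n((N\<^sub>1\<cdots>N\<^sub>n)\<^sup>-\<^sup>1 E)\<close>, i.e. the image of \<open>\<mu>\<^sub>>\<^sub>n\<close> under \<open>x \<mapsto> N\<^sub>1\<cdots>N\<^sub>n x\<close>.\<close>

definition moran_nu :: "(nat \<Rightarrow> nat) \<Rightarrow> (nat \<Rightarrow> nat set) \<Rightarrow> nat \<Rightarrow> real measure" where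
  "moran_nu N B n = distr (moran_tail N B n) borel (\<lambda>x. real (\<Prod>i=1..n. N i) * x)"

section \<open>Fourier transform and equi-positivity\<close>

definition fourier :: "real measure \<Rightarrow> real \<Rightarrow> complex" where
  "fourier M \<xi> = (CLINT x|M. exp (- (2 * of_real pi * \<i> * of_real \<xi> * of_real x)))"

definition prob_on_unit :: "real measure \<Rightarrow> bool" where
  "prob_on_unit M \<longleftrightarrow> real_distribution M \<and> measure M {0..1} = 1"

text \<open>For collections of Borel probability measures on \<open>[0,1]\<close>. This standing requirement is
  deliberately not a conjunct, so that a negated \<open>equi_positive\<close> cannot hold merely because it
  fails; the measures \<open>\<nu>\<^sub>>\<^sub>n\<close> always satisfy it (lemma \<open>prob_on_unit_moran_nu\<close>).\<close>

definition equi_positive :: "real measure set \<Rightarrow> bool" where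
  "equi_positive \<Phi> \<longleftrightarrow>
    (\<exists>\<epsilon>>0. \<forall>x\<in>{0..1::real}. \<forall>\<nu>\<in>\<Phi>. \<exists>k::int. norm (fourier \<nu> (x + of_int k)) \<ge> \<epsilon>)"

section \<open>Adequacy lemmas\<close>

lemma real_distribution_unif_dirac: "real_distribution (unif_dirac A)"
  unfolding unif_dirac_def by (rule prob_space.real_distribution_distr)
    (auto intro: measure_pmf.prob_space_axioms)

lemma measure_unif_dirac:
  assumes "finite A" "A \<noteq> {}" "E \<in> sets borel"
  shows "measure (unif_dirac A) E = (\<Sum>a\<in>A. measure (return borel a) E) / card A"
proof -
  have "measure (unif_dirac A) E = measure (measure_pmf (pmf_of_set A)) E"
    unfolding unif_dirac_def using assms by (subst measure_distr) auto
  also have "\<dots> = card (A \<inter> E) / card A"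
    using assms by (simp add: measure_pmf_of_set)
  also have "real (card (A \<inter> E)) = (\<Sum>a\<in>A. measure (return borel a) E)"
    using assms by (simp add: measure_return indicator_def sum.If_cases Int_def)
  finally show ?thesis .
qed

lemma AE_unif_dirac:
  assumes "finite A" "A \<noteq> {}" "A \<subseteq> E" "E \<in> sets borel"
  shows "AE x in unif_dirac A. x \<in> E"
  unfolding unif_dirac_def using assms
  by (subst AE_distr_iff) (auto simp: AE_measure_pmf_iff)

lemma real_distribution_convolution:
  assumes "real_distribution M" "real_distribution N"
  shows "real_distribution (M \<star> N)"
proof -
  interpret M: real_distribution M by fact
  interpret N: real_distribution N by fact
  interpret P: pair_prob_space M N ..
  show ?thesis unfolding convolution_def by (rule P.real_distribution_distr) simp
qed

lemma real_distribution_fin_conv: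
  assumes "\<And>i. real_distribution (D i)"
  shows "real_distribution (fin_conv D m)"
proof (induction m)
  case 0
  show ?case
    by (simp add: real_distribution_def real_distribution_axioms_def prob_space_return)
qed (auto intro: real_distribution_convolution assms)

lemma AE_convolution:
  assumes "real_distribution M" "real_distribution N"
    and "AE x in M. x \<in> {0..a}" "AE x in N. x \<in> {0..b}"
  shows "AE x in M \<star> N. x \<in> {0..a+b}"
proof -
  interpret M: real_distribution M by fact
  interpret N: real_distribution N by fact
  interpret P: pair_prob_space M N ..
  have "AE p in M \<Otimes>\<^sub>M N. (case p of (x, y) \<Rightarrow> x + y) \<in> {0..a+b}"
  proof (rule P.AE_pair_measure)
    show "{p \<in> space (M \<Otimes>\<^sub>M N). (case p of (x, y) \<Rightarrow> x + y) \<in> {0..a+b}} \<in> sets (M \<Otimes>\<^sub>M N)"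
      by measurable
    show "AE x in M. AE y in N. (case (x, y) of (x, y) \<Rightarrow> x + y) \<in> {0..a+b}"
      using assms(3)
    proof eventually_elim
      case (elim x)
      show ?case using assms(4) by eventually_elim (use elim in auto)
    qed
  qed
  then show ?thesis unfolding convolution_def by (subst AE_distr_iff) auto
qed

lemma cdf_convolution_le:
  assumes "real_distribution M" "real_distribution N" "AE x in N. 0 \<le> x"
  shows "cdf (M \<star> N) t \<le> cdf M t"
proof -
  interpret M: real_distribution M by fact
  interpret N: real_distribution N by fact
  interpret MN: real_distribution "M \<star> N" by (rule real_distribution_convolution) fact+
  have "emeasure (M \<star> N) {..t} = (\<integral>\<^sup>+x. \<integral>\<^sup>+y. indicator {..t} (x + y) \<partial>N \<partial>M)"
    by (rule convolution_emeasure') (auto intro: M.finite_measure_axioms N.finite_measure_axioms)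
  also have "\<dots> \<le> (\<integral>\<^sup>+x. \<integral>\<^sup>+y. indicator {..t} x \<partial>N \<partial>M)"
  proof (rule nn_integral_mono)
    fix x
    show "(\<integral>\<^sup>+y. indicator {..t} (x + y) \<partial>N) \<le> (\<integral>\<^sup>+y. indicator {..t} x \<partial>N)"
      using assms(3) by (intro nn_integral_mono_AE) (auto split: split_indicator)
  qed
  also have "\<dots> = emeasure M {..t}"
    using N.emeasure_space_1 by (simp add: N.space_eq_univ)
  finally show ?thesis
    unfolding cdf_def by (simp add: M.emeasure_eq_measure MN.emeasure_eq_measure)
qed

lemma weak_limit_unique:
  assumes "\<And>n. real_distribution (M n)" "real_distribution L" "real_distribution L'"
    and "weak_conv_m M L" "weak_conv_m M L'"
  shows "L = L'"
proof (rule Levy_uniqueness)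
  show "char L = char L'"
  proof
    fix t
    show "char L t = char L' t"
      using levy_continuity1[of M L t] levy_continuity1[of M L' t] assms
      by (blast intro: LIMSEQ_unique)
  qed
qed fact+

lemma inf_conv_eqI:
  assumes "\<And>i. real_distribution (D i)" "real_distribution M" "weak_conv_m (fin_conv D) M"
  shows "inf_conv D = M"
  unfolding inf_conv_def
proof (rule the_equality)
  fix L assume "real_distribution L \<and> weak_conv_m (fin_conv D) L"
  then show "L = M"
    using weak_limit_unique[of "fin_conv D" L M] real_distribution_fin_conv[of D] assms by blast
qed (use assms in auto)

lemma weak_limit_exists:
  assumes D: "\<And>i. real_distribution (D i)" and pos: "\<And>i. AE x in D i. 0 \<le> x"
    and bdd: "\<And>m. AE x in fin_conv D m. x \<in> {0..c}" and c: "0 \<le> c"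
  shows "\<exists>M. real_distribution M \<and> weak_conv_m (fin_conv D) M"
proof -
  have rd: "real_distribution (fin_conv D m)" for m
    by (rule real_distribution_fin_conv) fact
  have "tight (fin_conv D)"
    unfolding tight_def
  proof (intro conjI allI impI)
    fix e :: real assume "e > 0"
    have "measure (fin_conv D m) {-1<..c} = 1" for m
    proof -
      interpret real_distribution "fin_conv D m" by (rule rd)
      show ?thesis
        using bdd[of m] by (subst prob_eq_1) auto
    qed
    then show "\<exists>a b. a < b \<and> (\<forall>m. measure (fin_conv D m) {a<..b} > 1 - e)"
      using \<open>e > 0\<close> c by (intro exI[of _ "-1"] exI[of _ c]) auto
  qed (rule rd)
  from tight_imp_convergent_subsubsequence[OF this strict_mono_id]
  obtain r M where r: "strict_mono (r :: nat \<Rightarrow> nat)" and M: "real_distribution M"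
    and conv: "weak_conv_m (fin_conv D \<circ> id \<circ> r) M" by auto
  have "weak_conv_m (fin_conv D) M"
    unfolding weak_conv_m_def weak_conv_def
  proof (intro allI impI)
    fix x assume x: "isCont (cdf M) x"
    have dec: "decseq (\<lambda>m. cdf (fin_conv D m) x)"
      by (intro decseq_SucI) (auto intro!: cdf_convolution_le rd D pos)
    obtain L where L: "(\<lambda>m. cdf (fin_conv D m) x) \<longlonglongrightarrow> L"
      by (rule decseq_convergent[OF dec, of 0]) (auto simp: cdf_def)
    have "(\<lambda>m. cdf (fin_conv D (r m)) x) \<longlonglongrightarrow> L"
      using LIMSEQ_subseq_LIMSEQ[OF L r] by (simp add: o_def)
    moreover have "(\<lambda>m. cdf (fin_conv D (r m)) x) \<longlonglongrightarrow> cdf M x"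
      using conv x by (auto simp: weak_conv_m_def weak_conv_def)
    ultimately show "(\<lambda>m. cdf (fin_conv D m) x) \<longlonglongrightarrow> cdf M x"
      using L LIMSEQ_unique by blast
  qed
  with M show ?thesis by blast
qed

lemma weak_limit_support:
  assumes M: "\<And>m. real_distribution (M m)" and L: "real_distribution L" "weak_conv_m M L"
    and bdd: "\<And>m. AE x in M m. x \<in> {0..c}" and c: "0 \<le> c"
  shows "AE x in L. x \<in> {0..c}"
proof -
  interpret L: real_distribution L by fact
  define f where "f x = min 1 (max 0 (-x) + max 0 (x - c))" for x :: real
  have f0: "f x = 0 \<longleftrightarrow> x \<in> {0..c}" and f1: "0 \<le> f x" "f x \<le> 1" for x
    using c by (auto simp: f_def min_def max_def)
  have meas[measurable]: "f \<in> borel_measurable borel"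
    unfolding f_def by measurable
  have "(\<lambda>m. integral\<^sup>L (M m) f) \<longlonglongrightarrow> integral\<^sup>L L f"
  proof (rule weak_conv_imp_integral_bdd_continuous_conv)
    show "isCont f x" for x unfolding f_def by (intro continuous_intros)
    show "norm (f x) \<le> 1" for x using f1[of x] by simp
  qed (use M L in auto)
  moreover have "integral\<^sup>L (M m) f = 0" for m
    by (rule integral_eq_zero_AE) (use bdd[of m] f0 in auto)
  ultimately have "integral\<^sup>L L f = 0"
    by (simp add: LIMSEQ_const_iff)
  moreover have "integrable L f"
    by (rule L.integrable_const_bound[of _ 1]) (use f1 in auto)
  ultimately have "AE x in L. f x = 0"
    using f1 by (subst (asm) integral_nonneg_eq_0_iff_AE) auto
  then show ?thesis by (simp add: f0)
qed

lemma real_distribution_moran_factor: "real_distribution (moran_factor N B k)"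
  unfolding moran_factor_def by (rule real_distribution_unif_dirac)

lemma moran_prod_pos: "moran_data N B \<Longrightarrow> 0 < (\<Prod>i=1..k. N i)"
  by (rule prod_pos) (force simp: moran_data_def)

lemma AE_moran_factor:
  assumes "moran_data N B"
  shows "AE x in moran_factor N B (Suc k).
           x \<in> {0..1 / real (\<Prod>i=1..k. N i) - 1 / real (\<Prod>i=1..Suc k. N i)}"
proof -
  define P where "P = (\<Prod>i=1..k. N i)"
  have P: "0 < P" unfolding P_def by (rule moran_prod_pos) fact
  have N: "N (Suc k) \<ge> 2" "B (Suc k) \<noteq> {}" "B (Suc k) \<subseteq> {0..N (Suc k) - 1}"
    using assms by (auto simp: moran_data_def)
  have PS: "(\<Prod>i=1..Suc k. N i) = P * N (Suc k)" by (simp add: P_def)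
  have "(1::real) / P - 1 / (P * N (Suc k)) = (N (Suc k) - 1) / (P * N (Suc k))"
    using P N by (simp add: field_simps of_nat_diff)
  moreover have "real b / (P * N (Suc k)) \<le> (N (Suc k) - 1) / (P * N (Suc k))"
    if "b \<in> B (Suc k)" for b
    using that N P by (intro divide_right_mono) force+
  ultimately show ?thesis
    unfolding moran_factor_def P_def[symmetric] PS
    using N finite_subset[OF N(3)] P by (intro AE_unif_dirac) auto
qed

lemma AE_moran_fin_conv:
  assumes "moran_data N B"
  shows "AE x in fin_conv (\<lambda>k. moran_factor N B (Suc (n + k))) m.
           x \<in> {0..1 / real (\<Prod>i=1..n. N i) - 1 / real (\<Prod>i=1..n+m. N i)}"
proof (induction m)
  case 0
  show ?case unfolding fin_conv.simps by (subst AE_return) auto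
next
  case (Suc m)
  show ?case
    unfolding fin_conv.simps using AE_convolution[OF _ _ Suc AE_moran_factor[OF assms, of "n + m"]]
    by (simp add: real_distribution_fin_conv real_distribution_moran_factor)
qed

lemma AE_moran_fin_conv':
  assumes "moran_data N B"
  shows "AE x in fin_conv (\<lambda>k. moran_factor N B (Suc (n + k))) m. x \<in> {0..1 / real (\<Prod>i=1..n. N i)}"
  using AE_moran_fin_conv[OF assms, of n m]
proof eventually_elim
  case (elim x)
  have "0 \<le> 1 / real (\<Prod>i=1..n+m. N i)" by (intro divide_nonneg_nonneg of_nat_0_le_iff) simp
  with elim show ?case unfolding atLeastAtMost_iff by linarith
qed

lemma
  assumes "moran_data N B"
  shows real_distribution_moran_tail: "real_distribution (moran_tail N B n)"
    and weak_conv_moran_tail: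
      "weak_conv_m (fin_conv (\<lambda>k. moran_factor N B (Suc (n + k)))) (moran_tail N B n)"
proof -
  let ?D = "\<lambda>k. moran_factor N B (Suc (n + k))"
  have "\<exists>M. real_distribution M \<and> weak_conv_m (fin_conv ?D) M"
  proof (rule weak_limit_exists)
    show "AE x in ?D i. 0 \<le> x" for i
      using AE_moran_factor[OF assms, of "n + i"] by eventually_elim auto
    show "AE x in fin_conv ?D m. x \<in> {0..1 / real (\<Prod>i=1..n. N i)}" for m
      by (rule AE_moran_fin_conv') fact
  qed (auto simp: real_distribution_moran_factor simp del: of_nat_prod)
  then obtain M where M: "real_distribution M" "weak_conv_m (fin_conv ?D) M" by blast
  then have "moran_tail N B n = M"
    unfolding moran_tail_def by (intro inf_conv_eqI real_distribution_moran_factor)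
  with M show "real_distribution (moran_tail N B n)"
    "weak_conv_m (fin_conv ?D) (moran_tail N B n)" by auto
qed

lemma prob_on_unit_moran_nu:
  assumes "moran_data N B"
  shows "prob_on_unit (moran_nu N B n)"
proof -
  define P where "P = real (\<Prod>i=1..n. N i)"
  have P: "0 < P" unfolding P_def using moran_prod_pos[OF assms, of n] by (simp only: of_nat_0_less_iff)
  interpret T: real_distribution "moran_tail N B n"
    by (rule real_distribution_moran_tail) fact
  have nu: "moran_nu N B n = distr (moran_tail N B n) borel (\<lambda>x. P * x)"
    by (simp only: moran_nu_def P_def)
  interpret V: real_distribution "moran_nu N B n"
    unfolding nu by (rule T.real_distribution_distr) simp
  have "AE x in moran_tail N B n. x \<in> {0..1 / P}"
    using P by (intro weak_limit_support[OF _ real_distribution_moran_tail[OF assms]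
          weak_conv_moran_tail[OF assms]])
      (auto simp: P_def[symmetric] simp del: atLeastAtMost_iff of_nat_prod
         intro!: real_distribution_fin_conv real_distribution_moran_factor
           AE_moran_fin_conv'[OF assms, of n, folded P_def])
  then have "AE x in moran_tail N B n. P * x \<in> {0..1}"
    by eventually_elim (use P in \<open>auto simp: field_simps\<close>)
  then have "AE x in moran_nu N B n. x \<in> {0..1}"
    unfolding nu by (subst AE_distr_iff) auto
  then have "measure (moran_nu N B n) {0..1} = 1"
    by (subst V.prob_eq_1) auto
  then show ?thesis
    unfolding prob_on_unit_def by (simp add: V.real_distribution_axioms)
qed

lemma fourier_eq_char: "fourier M \<xi> = char M (- (2 * pi * \<xi>))"
  unfolding fourier_def char_def by (simp add: mult_ac)

lemma char_convolution:
  assumes "real_distribution M" "real_distribution N"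
  shows "char (M \<star> N) t = char M t * char N t"
proof -
  interpret M: real_distribution M by fact
  interpret N: real_distribution N by fact
  interpret P: pair_prob_space M N ..
  have "char (M \<star> N) t = (CLINT p|(M \<Otimes>\<^sub>M N). iexp (t * (case p of (x, y) \<Rightarrow> x + y)))"
    unfolding char_def convolution_def by (subst integral_distr) auto
  also have "\<dots> = (CLINT p|(M \<Otimes>\<^sub>M N). (case p of (x, y) \<Rightarrow> iexp (t * x) * iexp (t * y)))"
    by (intro Bochner_Integration.integral_cong) (auto simp: algebra_simps exp_add)
  also have "\<dots> = (CLINT x|M. CLINT y|N. iexp (t * x) * iexp (t * y))"
    by (subst P.integral_fst[symmetric])
       (auto intro!: P.P.integrable_const_bound[of _ 1] simp: norm_mult)
  also have "\<dots> = char M t * char N t"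
    unfolding char_def by simp
  finally show ?thesis .
qed

lemma cantor_moran_split:
  assumes "moran_data N B"
  shows "cantor_moran N B = (moran_head N B n \<star> moran_tail N B n)"
proof (rule Levy_uniqueness)
  let ?D = "\<lambda>k. moran_factor N B (Suc k)"
  have 0: "cantor_moran N B = moran_tail N B 0"
    by (simp add: cantor_moran_def moran_tail_def)
  show rd: "real_distribution (cantor_moran N B)"
    unfolding 0 by (rule real_distribution_moran_tail) fact
  have h: "real_distribution (moran_head N B n)"
    unfolding moran_head_def by (intro real_distribution_fin_conv real_distribution_moran_factor)
  then show "real_distribution (moran_head N B n \<star> moran_tail N B n)"
    by (intro real_distribution_convolution real_distribution_moran_tail assms)
  have fc: "char (fin_conv ?D (n + m)) t =
      char (moran_head N B n) t * char (fin_conv (\<lambda>k. moran_factor N B (Suc (n + k))) m) t" for m t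
  proof (induction m)
    case 0
    have "char (return borel 0) t = 1" by (simp add: char_def integral_return)
    then show ?case by (simp add: moran_head_def)
  next
    case (Suc m)
    then show ?case
      by (simp add: char_convolution real_distribution_fin_conv real_distribution_moran_factor mult_ac)
  qed
  show "char (cantor_moran N B) = char (moran_head N B n \<star> moran_tail N B n)"
  proof
    fix t
    have "(\<lambda>m. char (fin_conv ?D m) t) \<longlonglongrightarrow> char (cantor_moran N B) t"
      unfolding 0
      using levy_continuity1[OF _ real_distribution_moran_tail[OF assms, of 0]
          weak_conv_moran_tail[OF assms, of 0], of t]
      by (simp add: real_distribution_fin_conv real_distribution_moran_factor)
    then have "(\<lambda>m. char (fin_conv ?D (n + m)) t) \<longlonglongrightarrow> char (cantor_moran N B) t"
      using LIMSEQ_ignore_initial_segment[of _ _ n] by (simp add: add.commute)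
    moreover have "(\<lambda>m. char (fin_conv ?D (n + m)) t) \<longlonglongrightarrow>
        char (moran_head N B n) t * char (moran_tail N B n) t"
      unfolding fc
      by (intro tendsto_mult tendsto_const levy_continuity1 weak_conv_moran_tail
          real_distribution_moran_tail real_distribution_fin_conv real_distribution_moran_factor assms)
    ultimately show "char (cantor_moran N B) t = char (moran_head N B n \<star> moran_tail N B n) t"
      using h by (simp add: LIMSEQ_unique char_convolution real_distribution_moran_tail assms)
  qed
qed

end

theory Submission
  imports Defs
begin

text \<open>
  One example serves both parts. Let \<open>C\<close> be a finite set of positive integers whose sine sum
  is uniformly smaller than \<open>\<epsilon> * card C\<close>, and take \<open>B = C \<union> (N - C)\<close> with \<open>N\<close> much larger than
  \<open>Max C / \<epsilon>\<close>. Then \<open>B / N\<close> is concentrated near 0 and 1 with equal weights, while at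
  \<open>\<xi> = 1 / 2 + k\<close> the exponential sum over \<open>B / N\<close> collapses to a sine sum over \<open>C\<close>. Since the
  transform of \<open>\<nu>\<^sub>>\<^sub>n\<close> contains this sum as a factor, it tends to 0 uniformly on \<open>1 / 2 + \<int>\<close>, which
  contradicts equi-positivity of any subsequence at \<open>x = 1 / 2\<close>.

  The set \<open>C\<close> imitates the series \<open>\<Sum> sin (c x) / c\<close>, which has bounded partial sums but divergent
  coefficient sum: the weights \<open>1 / c\<close>, constant on dyadic blocks, are realised by replacing \<open>c\<close>
  with the integers within distance \<open>2^(n - j)\<close> of \<open>c * T\<close>.
\<close>


section \<open>Sine sums over dyadic blocks\<close>

lemma abs_sin_mult_le: "\<bar>sin (real n * x)\<bar> \<le> real n * \<bar>sin x\<bar>"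
proof (induction n)
  case (Suc n)
  have "\<bar>sin (real (Suc n) * x)\<bar> = \<bar>sin (real n * x) * cos x + cos (real n * x) * sin x\<bar>"
    by (simp add: algebra_simps sin_add)
  also have "\<dots> \<le> \<bar>sin (real n * x)\<bar> * \<bar>cos x\<bar> + \<bar>cos (real n * x)\<bar> * \<bar>sin x\<bar>"
    by (metis abs_mult abs_triangle_ineq)
  also have "\<dots> \<le> \<bar>sin (real n * x)\<bar> * 1 + 1 * \<bar>sin x\<bar>"
    by (intro add_mono mult_mono) auto
  finally show ?case using Suc by (simp add: algebra_simps)
qed simp

text \<open>Telescoping: \<open>2 * sin (x / 2) * sin (c * x)\<close> is the difference of the
  cosines at \<open>(c - 1/2) * x\<close> and \<open>(c + 1/2) * x\<close>. Keeping the sine factor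
  on the left avoids a case distinction on whether it vanishes.\<close>

lemma sin_half_mult_sum_sin:
  assumes "m \<le> n"
  shows "\<bar>sin (x / 2)\<bar> * \<bar>\<Sum>c\<in>{m..<n}. sin (real c * x)\<bar> \<le> 1"
proof -
  have "2 * sin (x / 2) * (\<Sum>c\<in>{m..<n}. sin (real c * x))
      = cos ((real m - 1 / 2) * x) - cos ((real n - 1 / 2) * x)"
    using assms
  proof (induction n rule: dec_induct)
    case (step n)
    have "2 * sin (x / 2) * sin (real n * x) = cos ((real n - 1 / 2) * x) - cos ((real (Suc n) - 1 / 2) * x)"
      using cos_diff[of "real n * x" "x / 2"] cos_add[of "real n * x" "x / 2"]
      by (simp add: algebra_simps)
    with step show ?case by (simp add: distrib_left)
  qed simp
  moreover have "\<bar>cos ((real m - 1 / 2) * x) - cos ((real n - 1 / 2) * x)\<bar> \<le> 2"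
    using abs_cos_le_one[of "(real m - 1 / 2) * x"] abs_cos_le_one[of "(real n - 1 / 2) * x"]
    by linarith
  ultimately have "\<bar>2 * sin (x / 2) * (\<Sum>c\<in>{m..<n}. sin (real c * x))\<bar> \<le> 2"
    by simp
  then show ?thesis by (simp add: abs_mult)
qed

definition dyadic_sine :: "nat \<Rightarrow> real \<Rightarrow> real" where
  "dyadic_sine j x = (\<Sum>c\<in>{2^j..<2^Suc j}. sin (real c * x))"

text \<open>The termwise estimate, useful when \<open>x\<close> is close to a multiple of 2 pi,
  where the telescoping bound is weak. Writing \<open>c * x\<close> as \<open>2 * c\<close> times
  \<open>x / 2\<close> expresses it through \<open>sin (x / 2)\<close>, so the two bounds can be
  combined without reducing \<open>x\<close> modulo 2 pi.\<close>

lemma abs_dyadic_sine_le: "\<bar>dyadic_sine j x\<bar> \<le> 2 ^ j * (4 * (2 ^ j * \<bar>sin (x / 2)\<bar>))"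
proof -
  have "\<bar>dyadic_sine j x\<bar> \<le> (\<Sum>c\<in>{2^j..<2^Suc j}. \<bar>sin (real c * x)\<bar>)"
    unfolding dyadic_sine_def by (rule sum_abs)
  also have "\<dots> \<le> (\<Sum>c\<in>{2^j..<(2::nat)^Suc j}. 4 * (2 ^ j * \<bar>sin (x / 2)\<bar>))"
  proof (rule sum_mono)
    fix c :: nat assume c: "c \<in> {2^j..<2^Suc j}"
    have "\<bar>sin (real c * x)\<bar> \<le> real (2 * c) * \<bar>sin (x / 2)\<bar>"
      using abs_sin_mult_le[of "2 * c" "x / 2"] by simp
    also have "real (2 * c) \<le> real (4 * 2 ^ j)" using c by (subst of_nat_le_iff) auto
    finally show "\<bar>sin (real c * x)\<bar> \<le> 4 * (2 ^ j * \<bar>sin (x / 2)\<bar>)" by (simp add: mult_right_mono)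
  qed
  finally show ?thesis by simp
qed

text \<open>With \<open>u = 2^j * \<bar>sin (x / 2)\<bar>\<close>, the \<open>j\<close>-th term is at most \<open>min (4 * u) (1 / u)\<close>, which the
  bounded function \<open>g\<close> dominates by its increment from \<open>u\<close> to \<open>2 * u\<close>, so the sum telescopes.\<close>

lemma sum_dyadic_sine_le: "(\<Sum>j<n. \<bar>dyadic_sine j x\<bar> / 2 ^ j) \<le> 24"
proof -
  define s where "s = \<bar>sin (x / 2)\<bar>"
  \<comment> \<open>The increment of \<open>g\<close> is
    \<open>24 * u / ((1 + u) * (1 + 2 * u))\<close>. For \<open>u \<le> 1\<close> the denominator is
    at most 6, so 24 = 4 * 6 yields \<open>4 * u\<close>. For \<open>u > 1\<close> it is at most
    \<open>6 * u^2\<close>, which yields \<open>4 / u\<close>.\<close>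
  define g where "g u = 24 * u / (1 + u)" for u :: real
  have s: "s \<ge> 0" by (simp add: s_def)
  have step: "\<bar>dyadic_sine j x\<bar> / 2 ^ j \<le> g (2 * u) - g u" if u: "u = 2 ^ j * s" for u j
  proof -
    have u0: "u \<ge> 0" using s u by simp
    have diff: "g (2 * u) - g u = 24 * u / ((1 + u) * (1 + 2 * u))"
      using u0 by (simp add: g_def field_simps)
    have 1: "\<bar>dyadic_sine j x\<bar> / 2 ^ j \<le> 4 * u"
      using abs_dyadic_sine_le[of j x] u by (simp add: s_def field_simps)
    have 2: "u * (\<bar>dyadic_sine j x\<bar> / 2 ^ j) \<le> 1"
      using sin_half_mult_sum_sin[of "2^j" "2^Suc j" x] u by (simp add: s_def dyadic_sine_def)
    show ?thesis
    proof (cases "u \<le> 1")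
      case True
      have "(1 + u) * (1 + 2 * u) \<le> 2 * 3" using True u0 by (intro mult_mono) auto
      then have "4 * u * ((1 + u) * (1 + 2 * u)) \<le> 4 * u * (2 * 3)"
        using u0 by (intro mult_left_mono) auto
      then have "4 * u \<le> 24 * u / ((1 + u) * (1 + 2 * u))" using u0 by (simp add: pos_le_divide_eq)
      then show ?thesis using 1 diff by linarith
    next
      case False
      have "(1 + u) * (1 + 2 * u) \<le> (2 * u) * (3 * u)" using False by (intro mult_mono) auto
      then have "1 / u \<le> 24 * u / ((1 + u) * (1 + 2 * u))" using False u0 by (simp add: field_simps)
      moreover have "\<bar>dyadic_sine j x\<bar> / 2 ^ j \<le> 1 / u" using 2 False by (simp add: field_simps)
      ultimately show ?thesis using diff by linarith
    qed
  qed
  have "(\<Sum>j<n. \<bar>dyadic_sine j x\<bar> / 2 ^ j) \<le> (\<Sum>j<n. g (2 ^ Suc j * s) - g (2 ^ j * s))"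
    by (intro sum_mono) (use step in \<open>auto simp: mult.assoc\<close>)
  also have "\<dots> = g (2 ^ n * s) - g s"
    using sum_lessThan_telescope[of "\<lambda>j. g (2 ^ j * s)" n] by simp
  also have "\<dots> \<le> 24"
  proof -
    have "0 \<le> g s" using s by (simp add: g_def)
    moreover have "g (2 ^ n * s) \<le> 24" using s by (simp add: g_def pos_divide_le_eq add_pos_nonneg)
    ultimately show ?thesis by simp
  qed
  finally show ?thesis .
qed

section \<open>A set of positive integers with uniformly small sine sum\<close>

text \<open>Averaging over the shifts multiplies the \<open>j\<close>-th dyadic sum by a cosine
  kernel of size at most \<open>3 * 2^(n-j)\<close>, so the total stays below
  \<open>3 * 2^n * 24\<close>. Each of the \<open>n\<close> blocks contributes at least
  \<open>2^(n+1)\<close> elements, so the ratio is at most \<open>36 / n\<close>.\<close>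

lemma ex_small_sine_sum:
  fixes \<epsilon> :: real
  assumes "\<epsilon> > 0"
  shows "\<exists>C::nat set. finite C \<and> C \<noteq> {} \<and> 0 \<notin> C \<and> (\<forall>x. \<bar>\<Sum>c\<in>C. sin (real c * x)\<bar> \<le> \<epsilon> * card C)"
proof -
  obtain n :: nat where n: "real n > 36 / \<epsilon>" using reals_Archimedean2 by blast
  then have n0: "n > 0" using assms by (cases n) (auto simp: field_simps)
  \<comment> \<open>All shifts satisfy \<open>\<bar>d\<bar> \<le> 2^n = T / 4\<close>, so the
    clusters around distinct multiples of \<open>T\<close> are disjoint and those around positive
    multiples stay positive.\<close>
  define T :: int where "T = 2 ^ (n + 2)"
  define I where "I = (SIGMA j:{..<n}. {2^j..<(2::nat)^Suc j} \<times> {-(2^(n-j))..2^(n-j)::int})"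
  define f where "f = (\<lambda>(j::nat, c::nat, d). int c * T + d)"
  have fin: "finite I" by (simp add: I_def)
  have c_pos: "c \<ge> 1" and d_T: "4 * \<bar>d\<bar> \<le> T"
    if "(j, c, d) \<in> I" for j c d
  proof -
    have "\<bar>d\<bar> \<le> 2 ^ (n - j)" using that by (auto simp: I_def)
    also have "\<dots> \<le> (2::int) ^ n" by (rule power_increasing) auto
    finally have "\<bar>d\<bar> \<le> 2 ^ n" .
    then show "4 * \<bar>d\<bar> \<le> T" by (simp add: T_def)
    have "1 \<le> (2::nat) ^ j" by simp
    also have "\<dots> \<le> c" using that by (simp add: I_def)
    finally show "c \<ge> 1" .
  qed
  have T: "T > 0" by (simp add: T_def)
  have f_pos: "f p > 0" if "p \<in> I" for p
  proof -
    obtain j c d where p: "p = (j, c, d)" by (cases p)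
    have "T * 1 \<le> T * int c" using T c_pos[of j c d] that p by (intro mult_left_mono) auto
    moreover have "f p = T * int c + d" by (simp add: p f_def)
    ultimately show ?thesis using d_T[of j c d] that T unfolding p by linarith
  qed
  have inj: "inj_on f I"
  proof (rule inj_onI)
    fix p q assume p: "p \<in> I" and q: "q \<in> I" and eq: "f p = f q"
    obtain j c d where pe: "p = (j, c, d)" by (cases p)
    obtain j' c' d' where qe: "q = (j', c', d')" by (cases q)
    have *: "(int c - int c') * T = d' - d" using eq by (simp add: f_def pe qe algebra_simps)
    have "\<bar>int c - int c'\<bar> * T < 1 * T"
    proof -
      have "\<bar>int c - int c'\<bar> * T = \<bar>(int c - int c') * T\<bar>" using T by (simp add: abs_mult)
      also have "\<dots> < T" unfolding * using d_T[of j c d] d_T[of j' c' d'] p q pe qe T by auto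
      finally show ?thesis by simp
    qed
    then have cc: "c = c'" using T by (subst (asm) mult_less_cancel_right_pos) auto
    with * have dd: "d = d'" by simp
    \<comment> \<open>The dyadic blocks are disjoint, so the centre \<open>c\<close> determines
      \<open>j\<close>.\<close>
    have "2 ^ j \<le> c" "c < 2 ^ Suc j'" "2 ^ j' \<le> c" "c < 2 ^ Suc j"
      using p q cc by (auto simp: pe qe I_def)
    then have "(2::nat) ^ j < 2 ^ Suc j'" "(2::nat) ^ j' < 2 ^ Suc j"
      by (blast intro: order.strict_trans1)+
    then have "j < Suc j'" "j' < Suc j" by (simp_all only: power_strict_increasing_iff one_less_numeral_iff semiring_norm)
    with cc dd show "p = q" by (simp add: pe qe)
  qed
  define C where "C = (\<lambda>p. nat (f p)) ` I"
  have inj': "inj_on (\<lambda>p. nat (f p)) I"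
    by (rule inj_onI) (metis f_pos inj inj_onD int_nat_eq less_imp_le)
  have sum_C: "(\<Sum>c\<in>C. h (real c)) = (\<Sum>p\<in>I. h (of_int (f p)))" for h :: "real \<Rightarrow> real"
    unfolding C_def sum.reindex[OF inj'] using f_pos
    by (intro sum.cong) (auto simp: less_imp_le)
  have card_d: "real (card {-(2^m)..2^m::int}) = 2 * 2 ^ m + 1" for m :: nat
    by simp
  \<comment> \<open>Block \<open>j\<close> has \<open>2^j\<close> centres with
    \<open>2 * 2^(n-j) + 1\<close> shifts each. The product exceeds \<open>2^(n+1)\<close> for every
    \<open>j\<close>: this is the divergence of the coefficient sum.\<close>
  have card_C: "real (card C) \<ge> real n * 2 ^ (n + 1)"
  proof -
    have "real n * 2 ^ (n + 1) = (\<Sum>j<n. 2 ^ (n + 1))" by simp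
    also have "\<dots> \<le> (\<Sum>j<n. 2 ^ j * (2 * 2 ^ (n - j) + 1))"
    proof (rule sum_mono)
      fix j assume "j \<in> {..<n}"
      then have "(2::real) ^ n = 2 ^ j * 2 ^ (n - j)" by (simp flip: power_add)
      then show "(2::real) ^ (n + 1) \<le> 2 ^ j * (2 * 2 ^ (n - j) + 1)" by (simp add: algebra_simps)
    qed
    also have "\<dots> = real (card I)"
      unfolding I_def by (simp add: card_cartesian_product del: power_Suc)
         (simp add: algebra_simps)
    also have "card I = card C" unfolding C_def by (rule card_image[OF inj', symmetric])
    finally show ?thesis .
  qed
  have bound: "\<bar>\<Sum>c\<in>C. sin (real c * x)\<bar> \<le> 72 * 2 ^ n" for x
  proof -
    define K where "K m = (\<Sum>d\<in>{-(2^m)..2^m::int}. cos (of_int d * x))" for m :: nat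
    \<comment> \<open>The shifts are symmetric about 0, so in the addition formula only the term
      with \<open>cos (d * x)\<close> survives and the kernel \<open>K\<close> factors out.\<close>
    have odd: "(\<Sum>d\<in>{-(2^m)..2^m::int}. sin (of_int d * x)) = 0" for m :: nat
    proof -
      have "(\<Sum>d\<in>{-(2^m)..2^m::int}. sin (of_int d * x)) = (\<Sum>d\<in>{-(2^m)..2^m::int}. - sin (of_int d * x))"
        by (rule sum.reindex_bij_witness[of _ uminus uminus]) auto
      then show ?thesis by (simp add: sum_negf)
    qed
    have "(\<Sum>c\<in>C. sin (real c * x)) = (\<Sum>(j,c,d)\<in>I. sin ((real c * of_int T + of_int d) * x))"
      unfolding sum_C[of "\<lambda>y. sin (y * x)"] by (intro sum.cong) (auto simp: f_def)
    also have "\<dots> = (\<Sum>j<n. \<Sum>c\<in>{2^j..<2^Suc j}. \<Sum>d\<in>{-(2^(n-j))..2^(n-j)::int}.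
        sin ((real c * of_int T + of_int d) * x))"
      unfolding I_def by (subst sum.Sigma[symmetric]) (auto simp: sum.cartesian_product)
    also have "\<dots> = (\<Sum>j<n. K (n - j) * dyadic_sine j (of_int T * x))"
    proof (intro sum.cong refl)
      fix j
      have "(\<Sum>d\<in>{-(2^(n-j))..2^(n-j)::int}. sin ((real c * of_int T + of_int d) * x))
          = K (n - j) * sin (real c * (of_int T * x))" for c
      proof -
        have "sin ((real c * of_int T + of_int d) * x)
            = sin (real c * (of_int T * x)) * cos (of_int d * x)
              + cos (real c * (of_int T * x)) * sin (of_int d * x)" for d
          unfolding sin_add[symmetric] by (simp add: algebra_simps)
        then show ?thesis
          unfolding K_def using odd[of "n - j"] by (simp add: sum.distrib flip: sum_distrib_left)
      qed
      then show "(\<Sum>c\<in>{2^j..<2^Suc j}. \<Sum>d\<in>{-(2^(n-j))..2^(n-j)::int}.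
          sin ((real c * of_int T + of_int d) * x)) = K (n - j) * dyadic_sine j (of_int T * x)"
        by (simp add: dyadic_sine_def sum_distrib_left)
    qed
    finally have eq: "(\<Sum>c\<in>C. sin (real c * x)) = \<dots>" .
    have K_le: "\<bar>K m\<bar> \<le> 3 * 2 ^ m" for m
    proof -
      have "\<bar>K m\<bar> \<le> (\<Sum>d\<in>{-(2^m)..2^m::int}. 1)"
        unfolding K_def by (rule order.trans[OF sum_abs]) (intro sum_mono abs_cos_le_one)
      also have "\<dots> = 2 * 2 ^ m + 1" using card_d[of m] by simp
      also have "\<dots> \<le> 3 * 2 ^ m" by simp
      finally show ?thesis .
    qed
    have "\<bar>\<Sum>c\<in>C. sin (real c * x)\<bar> \<le> (\<Sum>j<n. \<bar>K (n - j)\<bar> * \<bar>dyadic_sine j (of_int T * x)\<bar>)"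
      unfolding eq abs_mult[symmetric] by (rule sum_abs)
    \<comment> \<open>The number of shifts turns into the weight:
      \<open>2^(n-j) = 2^n / 2^j\<close>.\<close>
    also have "\<dots> \<le> (\<Sum>j<n. 3 * 2 ^ n * (\<bar>dyadic_sine j (of_int T * x)\<bar> / 2 ^ j))"
    proof (rule sum_mono)
      fix j assume "j \<in> {..<n}"
      then have "(2::real) ^ (n - j) = 2 ^ n / 2 ^ j" by (simp add: power_diff)
      then show "\<bar>K (n - j)\<bar> * \<bar>dyadic_sine j (of_int T * x)\<bar>
          \<le> 3 * 2 ^ n * (\<bar>dyadic_sine j (of_int T * x)\<bar> / 2 ^ j)"
        using mult_right_mono[OF K_le[of "n - j"], of "\<bar>dyadic_sine j (of_int T * x)\<bar>"] by simp
    qed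
    also have "\<dots> = 3 * 2 ^ n * (\<Sum>j<n. \<bar>dyadic_sine j (of_int T * x)\<bar> / 2 ^ j)"
      by (rule sum_distrib_left[symmetric])
    also have "\<dots> \<le> 3 * 2 ^ n * 24"
      by (intro mult_left_mono sum_dyadic_sine_le) simp
    finally show ?thesis by simp
  qed
  have "72 * 2 ^ n \<le> \<epsilon> * card C"
  proof -
    have "36 \<le> \<epsilon> * real n" using n assms by (simp add: field_simps)
    then have "36 * 2 ^ (n + 1) \<le> \<epsilon> * real n * 2 ^ (n + 1)" by (intro mult_right_mono) auto
    also have "\<dots> \<le> \<epsilon> * card C" using card_C assms by (simp add: mult.assoc)
    finally show ?thesis by simp
  qed
  then have small: "\<bar>\<Sum>c\<in>C. sin (real c * x)\<bar> \<le> \<epsilon> * card C" for x using bound[of x] by linarith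
  have "0 < real n * 2 ^ (n + 1)" using n0 by simp
  then have "C \<noteq> {}" using card_C by (metis card.empty not_le of_nat_0)
  moreover have "0 \<notin> C" using f_pos by (force simp: C_def)
  moreover have "finite C" using fin by (simp add: C_def)
  ultimately show ?thesis using small by blast
qed


section \<open>Characteristic functions of the Moran tails\<close>

text \<open>The characteristic function of the uniform measure on \<open>B\<close>, for finite
  nonempty \<open>B\<close>. The frequency is angular, so the factor 2 pi enters only through
  \<open>fourier_eq_char\<close>.\<close>

definition mask :: "nat set \<Rightarrow> real \<Rightarrow> complex" where
  "mask B x = (\<Sum>b\<in>B. cis (real b * x)) / of_nat (card B)"

lemma char_unif_dirac:
  assumes "finite A" "A \<noteq> {}"
  shows "char (unif_dirac A) t = (\<Sum>a\<in>A. cis (t * a)) / of_nat (card A)"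
proof -
  have "char (unif_dirac A) t = (CLINT a|pmf_of_set A. cis (t * a))"
    unfolding char_def unif_dirac_def by (subst integral_distr) (auto simp: cis_conv_exp)
  also have "\<dots> = (\<Sum>a\<in>A. pmf (pmf_of_set A) a *\<^sub>R cis (t * a))"
    using assms by (intro integral_measure_pmf) auto
  also have "\<dots> = (\<Sum>a\<in>A. cis (t * a)) / of_nat (card A)"
    using assms by (simp add: sum_divide_distrib scaleR_conv_of_real)
  finally show ?thesis .
qed

lemma char_unif_dirac_scaled:
  assumes "finite B" "B \<noteq> {}" "q > 0"
  shows "char (unif_dirac ((\<lambda>b. real b / q) ` B)) t = mask B (t / q)"
proof -
  have inj: "inj_on (\<lambda>b. real b / q) B" using assms by (auto simp: inj_on_def)
  show ?thesis
    using assms by (simp add: char_unif_dirac sum.reindex[OF inj] card_image[OF inj] mask_def mult.commute)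
qed

lemma char_fin_conv:
  assumes "\<And>i. real_distribution (D i)"
  shows "char (fin_conv D m) t = (\<Prod>i<m. char (D i) t)"
proof (induction m)
  case 0
  show ?case by (simp add: char_def integral_return)
next
  case (Suc m)
  then show ?case using assms by (simp add: char_convolution real_distribution_fin_conv)
qed

lemma char_moran_tail_LIMSEQ:
  assumes "moran_data N B"
  shows "(\<lambda>m. \<Prod>i<m. char (moran_factor N B (Suc (n + i))) t) \<longlonglongrightarrow> char (moran_tail N B n) t"
  using levy_continuity1[OF _ real_distribution_moran_tail[OF assms] weak_conv_moran_tail[OF assms], of n t]
  by (simp add: char_fin_conv real_distribution_fin_conv real_distribution_moran_factor)

lemma char_moran_tail_Suc:
  assumes "moran_data N B"
  shows "char (moran_tail N B n) t =
    char (moran_factor N B (Suc n)) t * char (moran_tail N B (Suc n)) t"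
proof (rule LIMSEQ_unique)
  show "(\<lambda>m. \<Prod>i<Suc m. char (moran_factor N B (Suc (n + i))) t) \<longlonglongrightarrow> char (moran_tail N B n) t"
    using char_moran_tail_LIMSEQ[OF assms] by (rule LIMSEQ_Suc)
  show "(\<lambda>m. \<Prod>i<Suc m. char (moran_factor N B (Suc (n + i))) t) \<longlonglongrightarrow>
    char (moran_factor N B (Suc n)) t * char (moran_tail N B (Suc n)) t"
    unfolding prod.lessThan_Suc_shift using char_moran_tail_LIMSEQ[OF assms, of "Suc n" t]
    by (auto intro: tendsto_mult_left)
qed

lemma char_moran_nu:
  assumes "moran_data N B"
  shows "char (moran_nu N B n) t = char (moran_tail N B n) (real (\<Prod>i=1..n. N i) * t)"
proof -
  interpret real_distribution "moran_tail N B n"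
    by (rule real_distribution_moran_tail) fact
  show ?thesis
    unfolding moran_nu_def char_def by (subst integral_distr) (auto simp: mult_ac)
qed

text \<open>Self-similarity: the first digit splits off, and the rest is the next tail contracted by
  \<open>N (Suc n)\<close>, hence the same argument in both factors. At half-integer frequencies the
  first factor is made small; at fixed \<open>t\<close> the second is made close to 1.\<close>

lemma char_moran_nu_Suc:
  assumes "moran_data N B"
  shows "char (moran_nu N B n) t =
    mask (B (Suc n)) (t / N (Suc n)) * char (moran_nu N B (Suc n)) (t / N (Suc n))"
proof -
  define P where "P = (\<Prod>i=1..n. N i)"
  have P: "P > 0" unfolding P_def by (rule moran_prod_pos) fact
  have PS: "(\<Prod>i=1..Suc n. N i) = P * N (Suc n)" by (simp add: P_def)
  have N: "N (Suc n) \<ge> 2" "B (Suc n) \<noteq> {}" "finite (B (Suc n))"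
    using assms by (auto simp: moran_data_def intro: finite_subset)
  have "char (moran_factor N B (Suc n)) (real P * t) = mask (B (Suc n)) (t / N (Suc n))"
    unfolding moran_factor_def PS using P N by (subst char_unif_dirac_scaled) auto
  then show ?thesis
    unfolding char_moran_nu[OF assms] PS P_def[symmetric] char_moran_tail_Suc[OF assms, of n]
    using N by simp
qed

text \<open>On \<open>[0,1]\<close> the integrand is within
  \<open>\<bar>t * x\<bar> \<le> \<bar>t\<bar>\<close> of 1. This controls the contracted tail at
  \<open>t / N\<close> for large \<open>N\<close>.\<close>

lemma norm_char_minus_1_le:
  assumes "prob_on_unit M"
  shows "norm (char M t - 1) \<le> \<bar>t\<bar>"
proof -
  interpret real_distribution M using assms by (simp add: prob_on_unit_def)
  have unit: "AE x in M. x \<in> {0..1}"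
    using assms prob_eq_1[of "{0..1}"] by (simp add: prob_on_unit_def)
  have int: "integrable M (\<lambda>x. iexp (t * x))"
    by (rule integrable_const_bound[of _ 1]) auto
  have "char M t - 1 = (CLINT x|M. iexp (t * x) - 1)"
    unfolding char_def using int by (subst Bochner_Integration.integral_diff) (auto simp: prob_space[unfolded space_eq_univ])
  also have "norm \<dots> \<le> (LINT x|M. norm (iexp (t * x) - 1))" by (rule integral_norm_bound)
  also have "\<dots> \<le> (LINT x|M. \<bar>t\<bar>)"
  proof (rule integral_mono_AE)
    show "integrable M (\<lambda>x. norm (iexp (t * x) - 1))"
      using int by (intro integrable_norm Bochner_Integration.integrable_diff) auto
    show "AE x in M. norm (iexp (t * x) - 1) \<le> \<bar>t\<bar>"
      using unit
    proof eventually_elim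
      case (elim x)
      have "norm (iexp (t * x) - 1) \<le> \<bar>t * x\<bar>" using iexp_approx1[of "t * x" 0] by simp
      also have "\<dots> \<le> \<bar>t\<bar>" using elim by (simp add: abs_mult mult_left_le)
      finally show ?case .
    qed
  qed auto
  also have "\<dots> = \<bar>t\<bar>" by (simp add: prob_space[unfolded space_eq_univ])
  finally show ?thesis .
qed

lemma norm_cis_diff_le: "norm (cis x - cis y) \<le> \<bar>x - y\<bar>"
proof -
  have "cis x - cis y = cis y * (cis (x - y) - 1)" by (simp add: algebra_simps cis_mult)
  then show ?thesis
    using iexp_approx1[of "x - y" 0] by (simp add: norm_mult cis_conv_exp)
qed

lemma char_half_dirac: "char (unif_dirac {0, 1}) t = (1 + cis t) / 2"
  by (subst char_unif_dirac) auto

lemma cis_half_integer: "cis (2 * pi * (1 / 2 + of_int k)) = -1"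
proof -
  have "cis (2 * pi * (1 / 2 + of_int k)) = cis pi * cis (2 * pi * of_int k)"
    unfolding cis_mult by (simp add: algebra_simps)
  then show ?thesis by (simp add: cis_multiple_2pi)
qed

lemma fourier_half_dirac_eq_0: "fourier (unif_dirac {0, 1}) (1 / 2 + of_int k) = 0"
  using cis_half_integer[of k] by (simp add: fourier_eq_char char_half_dirac flip: cis_cnj)

section \<open>The digit set of a single level\<close>

lemma ex_moran_digits:
  assumes "\<epsilon> > 0"
  shows "\<exists>N B. 2 \<le> N \<and> 1 / \<epsilon> \<le> real N \<and> B \<noteq> {} \<and> B \<subseteq> {0..N - 1} \<and>
    (\<forall>k. norm (mask B (- (2 * pi * (1 / 2 + of_int k)) / real N)) \<le> \<epsilon>) \<and>
    (\<forall>t. norm (mask B (t / real N) - (1 + cis t) / 2) \<le> \<epsilon> * \<bar>t\<bar>)"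
proof -
  obtain C :: "nat set" where C: "finite C" "C \<noteq> {}" "0 \<notin> C"
    and small: "\<And>x. \<bar>\<Sum>c\<in>C. sin (real c * x)\<bar> \<le> \<epsilon> * card C"
    using ex_small_sine_sum[OF assms] by blast
  define M where "M = Max C"
  have M: "c \<le> M" if "c \<in> C" for c using that C by (simp add: M_def)
  obtain L :: nat where L: "1 / \<epsilon> \<le> real L" using real_arch_simple by blast
  \<comment> \<open>The summand \<open>L * M\<close> makes every \<open>c / N\<close> at most
    \<open>\<epsilon>\<close>, \<open>L\<close> gives \<open>1 / \<epsilon> \<le> N\<close>, and
    \<open>2 * M + 2\<close> gives \<open>2 * c < N\<close>, which separates \<open>C\<close> from
    its reflection.\<close>
  define N where "N = L * M + L + 2 * M + 2"
  define B where "B = C \<union> (\<lambda>c. N - c) ` C"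
  have lt: "2 * c < N" "1 \<le> c" if "c \<in> C" for c
    using M[OF that] C that by (auto simp: N_def Suc_le_eq intro: Nat.gr0I)
  have N0: "real N > 0" by (simp add: N_def add_nonneg_pos del: of_nat_add of_nat_mult)
  have c_le: "real c / N \<le> \<epsilon>" if "c \<in> C" for c
  proof -
    have "real c * 1 \<le> real M * (\<epsilon> * real L)"
      using M[OF that] L assms by (intro mult_mono) (auto simp: field_simps)
    also have "\<dots> = \<epsilon> * real (L * M)" by simp
    also have "\<dots> \<le> \<epsilon> * real N" using assms unfolding N_def by (intro mult_left_mono) (auto simp del: of_nat_mult)
    finally show ?thesis using N0 by (simp add: field_simps)
  qed
  have disj: "C \<inter> (\<lambda>c. N - c) ` C = {}"
  proof -
    have "c \<noteq> N - c'" if "c \<in> C" "c' \<in> C" for c c' using lt(1)[of c] lt(1)[of c'] that by linarith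
    then show ?thesis by blast
  qed
  have inj: "inj_on (\<lambda>c. N - c) C"
  proof (rule inj_onI)
    fix c c' assume "c \<in> C" "c' \<in> C" "N - c = N - c'"
    then show "c = c'" using lt(1)[of c] lt(1)[of c'] by linarith
  qed
  have card_B: "card B = 2 * card C"
    unfolding B_def using C disj by (simp add: card_Un_disjoint card_image[OF inj])
  have card_C: "real (card C) > 0" using C by (simp add: card_gt_0_iff)
  have mask_B: "mask B (t / real N) =
      (\<Sum>c\<in>C. cis (real c / N * t) + cis (t - real c / N * t)) / (2 * of_nat (card C))" for t
  proof -
    have "(\<Sum>b\<in>B. cis (real b * (t / real N)))
        = (\<Sum>c\<in>C. cis (real c * (t / real N))) + (\<Sum>c\<in>C. cis (real (N - c) * (t / real N)))"
      unfolding B_def using C disj by (subst sum.union_disjoint) (auto simp: sum.reindex[OF inj])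
    also have "(\<Sum>c\<in>C. cis (real (N - c) * (t / real N))) = (\<Sum>c\<in>C. cis (t - real c / N * t))"
    proof (intro sum.cong refl arg_cong[of _ _ cis])
      fix c assume "c \<in> C"
      then have "real (N - c) = real N - real c" using lt[of c] by (simp add: of_nat_diff)
      then show "real (N - c) * (t / real N) = t - real c / N * t" using N0 by (simp add: field_simps)
    qed
    finally show ?thesis by (simp add: mask_def card_B sum.distrib)
  qed
  have half: "norm (mask B (- (2 * pi * (1 / 2 + of_int k)) / real N)) \<le> \<epsilon>" for k
  proof -
    define t where "t = - (2 * pi * (1 / 2 + of_int k))"
    have t: "cis t = -1" using cis_half_integer[of k] unfolding t_def by (simp flip: cis_cnj)
    \<comment> \<open>Since \<open>cis t = -1\<close>, the reflected term is minus the conjugate of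
      \<open>cis y\<close>, so the real parts cancel. This is where half-integer frequencies are
      used.\<close>
    have "cis y + cis (t - y) = 2 * \<i> * of_real (sin y)" for y
    proof -
      have "cis (t - y) = - cnj (cis y)" using t by (simp flip: cis_divide add: cis_cnj cis_inverse divide_inverse)
      then show ?thesis by (simp add: complex_eq_iff)
    qed
    then have "mask B (t / real N) = 2 * \<i> * of_real (\<Sum>c\<in>C. sin (real c / N * t)) / (2 * of_nat (card C))"
      unfolding mask_B by (simp add: sum_distrib_left)
    then have "norm (mask B (t / real N)) = \<bar>\<Sum>c\<in>C. sin (real c * (t / N))\<bar> / card C"
      by (simp add: norm_mult norm_divide flip: of_real_sum)
    also have "\<dots> \<le> \<epsilon>" using small[of "t / N"] card_C by (simp add: field_simps)
    finally show ?thesis by (simp add: t_def)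
  qed
  have near: "norm (mask B (t / real N) - (1 + cis t) / 2) \<le> \<epsilon> * \<bar>t\<bar>" for t
  proof -
    \<comment> \<open>Each \<open>c\<close> is compared with the atom at 0 and its mirror image
      \<open>N - c\<close> with the atom at 1; both lie within \<open>\<epsilon>\<close> after
      division by \<open>N\<close>.\<close>
    have "mask B (t / real N) - (1 + cis t) / 2
        = (\<Sum>c\<in>C. (cis (real c / N * t) - cis 0) + (cis (t - real c / N * t) - cis t)) / (2 * of_nat (card C))"
      using card_C by (simp add: mask_B sum.distrib sum_subtractf field_simps)
    also have "norm \<dots> \<le> (\<Sum>c\<in>C. 2 * (\<epsilon> * \<bar>t\<bar>)) / (2 * card C)"
    proof -
      have "norm ((cis (real c / N * t) - cis 0) + (cis (t - real c / N * t) - cis t)) \<le> 2 * (\<epsilon> * \<bar>t\<bar>)"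
        if c: "c \<in> C" for c
      proof -
        define y where "y = real c / N * t"
        have "\<bar>y\<bar> \<le> \<epsilon> * \<bar>t\<bar>"
          using c_le[OF c] by (simp add: y_def abs_mult mult_right_mono del: times_divide_eq_left)
        moreover have "norm (cis y - cis 0) \<le> \<bar>y\<bar>" "norm (cis (t - y) - cis t) \<le> \<bar>y\<bar>"
          using norm_cis_diff_le[of y 0] norm_cis_diff_le[of "t - y" t] by simp_all
        ultimately show ?thesis
          using norm_triangle_ineq[of "cis y - cis 0" "cis (t - y) - cis t"]
          unfolding y_def[symmetric] by linarith
      qed
      then show ?thesis
        unfolding norm_divide by (intro frac_le order.trans[OF norm_sum sum_mono]) (use assms card_C in \<open>auto simp: norm_mult\<close>)
    qed
    also have "\<dots> = \<epsilon> * \<bar>t\<bar>" using card_C by simp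
    finally show ?thesis .
  qed
  have "2 \<le> N" by (simp add: N_def)
  moreover have "1 / \<epsilon> \<le> real N"
    by (rule order.trans[OF L]) (simp add: N_def del: of_nat_add of_nat_mult)
  moreover have "B \<noteq> {}" using C by (simp add: B_def)
  moreover have "B \<subseteq> {0..N - 1}" using lt by (force simp: B_def)
  ultimately show ?thesis using half near by blast
qed

section \<open>The common example for both claims\<close>

theorem theorem1p9:
  shows "(\<exists>(N :: nat \<Rightarrow> nat) (B :: nat \<Rightarrow> nat set). moran_data N B \<and>
            \<not> (\<exists>r :: nat \<Rightarrow> nat. strict_mono r \<and> equi_positive (range (\<lambda>j. moran_nu N B (r j)))))
       \<and> (\<exists>(N :: nat \<Rightarrow> nat) (B :: nat \<Rightarrow> nat set). moran_data N B \<and>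
            (\<forall>n. prob_on_unit (moran_nu N B n)) \<and>
            weak_conv_m (moran_nu N B) (unif_dirac {0, 1}) \<and>
            \<not> compact (range (\<lambda>k::int. 1 / 2 + real_of_int k)) \<and>
            uniform_limit (range (\<lambda>k::int. 1 / 2 + real_of_int k))
              (\<lambda>n. fourier (moran_nu N B n)) (fourier (unif_dirac {0, 1})) sequentially)"
proof -
  \<comment> \<open>The levels are chosen independently with tolerances tending to 0.
    \<open>Suc\<close> keeps \<open>e 0\<close> positive, so the choice also covers the irrelevant
    index 0.\<close>
  define e where "e n = 1 / real (Suc n)" for n
  have "\<forall>n. \<exists>N B. 2 \<le> N \<and> 1 / e n \<le> real N \<and> B \<noteq> {} \<and> B \<subseteq> {0..N - 1} \<and>
    (\<forall>k. norm (mask B (- (2 * pi * (1 / 2 + of_int k)) / real N)) \<le> e n) \<and>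
    (\<forall>t. norm (mask B (t / real N) - (1 + cis t) / 2) \<le> e n * \<bar>t\<bar>)"
    by (intro allI ex_moran_digits) (simp add: e_def)
  then obtain N B where NB: "\<And>n. 2 \<le> N n" "\<And>n. 1 / e n \<le> real (N n)" "\<And>n. B n \<noteq> {}" "\<And>n. B n \<subseteq> {0..N n - 1}"
    and half: "\<And>n k. norm (mask (B n) (- (2 * pi * (1 / 2 + of_int k)) / real (N n))) \<le> e n"
    and near: "\<And>n t. norm (mask (B n) (t / real (N n)) - (1 + cis t) / 2) \<le> e n * \<bar>t\<bar>"
    by metis
  have e_lim: "(\<lambda>n. e (Suc n)) \<longlonglongrightarrow> 0"
    unfolding e_def using LIMSEQ_Suc[OF LIMSEQ_inverse_real_of_nat] by (simp add: inverse_eq_divide)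
  have md: "moran_data N B" using NB by (auto simp: moran_data_def)
  have unit: "prob_on_unit (moran_nu N B n)" for n by (rule prob_on_unit_moran_nu) fact
  then have rd: "real_distribution (moran_nu N B n)" for n by (simp add: prob_on_unit_def)
  have le_1: "norm (char (moran_nu N B n) t) \<le> 1" for n t
    by (rule real_distribution.cmod_char_le_1) (rule rd)
  \<comment> \<open>The leading digit of the \<open>n\<close>-th tail belongs to level
    \<open>Suc n\<close>; its mask is at most \<open>e (Suc n)\<close> at half-integers, and the
    remaining factor has modulus at most 1. The bound does not depend on \<open>k\<close>.\<close>
  have four: "norm (fourier (moran_nu N B n) (1 / 2 + of_int k)) \<le> e (Suc n)" for n k
  proof -
    have "norm (fourier (moran_nu N B n) (1 / 2 + of_int k)) \<le> e (Suc n) * 1"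
      unfolding fourier_eq_char char_moran_nu_Suc[OF md, of n] norm_mult
      by (intro mult_mono half le_1) (auto simp: e_def)
    then show ?thesis by simp
  qed
  have unif: "uniform_limit (range (\<lambda>k::int. 1 / 2 + real_of_int k))
      (\<lambda>n. fourier (moran_nu N B n)) (fourier (unif_dirac {0, 1})) sequentially"
  proof (rule uniform_limitI)
    fix \<epsilon> :: real assume "\<epsilon> > 0"
    with e_lim have "\<forall>\<^sub>F n in sequentially. e (Suc n) < \<epsilon>" by (rule order_tendstoD)
    then show "\<forall>\<^sub>F n in sequentially. \<forall>x\<in>range (\<lambda>k::int. 1 / 2 + real_of_int k).
        dist (fourier (moran_nu N B n) x) (fourier (unif_dirac {0, 1}) x) < \<epsilon>"
    proof eventually_elim
      case (elim n)
      then show ?case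
        using four[of n] by (auto simp: fourier_half_dirac_eq_0 intro: order.strict_trans1)
    qed
  qed
  have weak: "weak_conv_m (moran_nu N B) (unif_dirac {0, 1})"
  proof (rule levy_continuity[OF rd real_distribution_unif_dirac])
    fix t
    have "norm (char (moran_nu N B n) t - char (unif_dirac {0, 1}) t) \<le> e (Suc n) * (2 * \<bar>t\<bar>)" for n
    proof -
      define s where "s = t / N (Suc n)"
      define a where "a = mask (B (Suc n)) s"
      define b where "b = char (moran_nu N B (Suc n)) s"
      have "1 / e (Suc n) \<le> real (N (Suc n))" by (rule NB)
      then have "1 / real (N (Suc n)) \<le> e (Suc n)" using NB(1)[of "Suc n"] by (simp add: e_def field_simps)
      then have "\<bar>s\<bar> \<le> e (Suc n) * \<bar>t\<bar>"
        using mult_right_mono[of "1 / real (N (Suc n))" "e (Suc n)" "\<bar>t\<bar>"] by (simp add: s_def)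
      then have b: "norm (b - 1) \<le> e (Suc n) * \<bar>t\<bar>"
        using norm_char_minus_1_le[OF unit, of "Suc n" s] unfolding b_def by linarith
      \<comment> \<open>Two errors are separated: replacing the leading digit by the two-point
        measure, and dropping the contracted tail. Each costs at most
        \<open>e (Suc n) * \<bar>t\<bar>\<close>.\<close>
      have "char (moran_nu N B n) t - char (unif_dirac {0, 1}) t = (a - (1 + cis t) / 2) * b + (1 + cis t) / 2 * (b - 1)"
        unfolding char_moran_nu_Suc[OF md, of n] char_half_dirac a_def b_def s_def by (simp add: algebra_simps)
      also have "norm \<dots> \<le> norm (a - (1 + cis t) / 2) * norm b + norm ((1 + cis t) / 2) * norm (b - 1)"
        by (metis norm_mult norm_triangle_ineq)
      also have "\<dots> \<le> (e (Suc n) * \<bar>t\<bar>) * 1 + 1 * (e (Suc n) * \<bar>t\<bar>)"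
      proof (intro add_mono mult_mono b)
        show "norm (a - (1 + cis t) / 2) \<le> e (Suc n) * \<bar>t\<bar>" unfolding a_def s_def by (rule near)
        show "norm b \<le> 1" unfolding b_def by (rule le_1)
        show "norm ((1 + cis t) / 2) \<le> 1" using norm_triangle_ineq[of 1 "cis t"] by (simp add: norm_divide)
      qed (auto simp: e_def)
      finally show ?thesis by (simp add: mult_ac)
    qed
    then have "(\<lambda>n. char (moran_nu N B n) t - char (unif_dirac {0, 1}) t) \<longlonglongrightarrow> 0"
      by (intro Lim_null_comparison[OF _ tendsto_mult_left_zero[OF e_lim]] always_eventually) blast
    then show "(\<lambda>n. char (moran_nu N B n) t) \<longlonglongrightarrow> char (unif_dirac {0, 1}) t"
      by (simp add: LIM_zero_iff)
  qed
  have noncompact: "\<not> compact (range (\<lambda>k::int. 1 / 2 + real_of_int k))"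
  proof
    assume "compact (range (\<lambda>k::int. 1 / 2 + real_of_int k))"
    then have "bounded (range (\<lambda>k::int. 1 / 2 + real_of_int k))" by (rule compact_imp_bounded)
    then obtain a where a: "\<And>k::int. \<bar>1 / 2 + real_of_int k\<bar> \<le> a"
      unfolding bounded_iff real_norm_def by blast
    obtain k :: int where "real_of_int k > a" using ex_less_of_int by blast
    with a[of k] show False by linarith
  qed
  have "\<not> equi_positive (range (\<lambda>j. moran_nu N B (r j)))" if r: "strict_mono r" for r :: "nat \<Rightarrow> nat"
  proof
    assume "equi_positive (range (\<lambda>j. moran_nu N B (r j)))"
    then obtain \<epsilon> where \<epsilon>: "\<epsilon> > 0"
      and pos: "\<And>x j. x \<in> {0..1} \<Longrightarrow> \<exists>k. \<epsilon> \<le> norm (fourier (moran_nu N B (r j)) (x + of_int k))"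
      unfolding equi_positive_def by blast
    \<comment> \<open>At \<open>x = 1 / 2\<close> no integer translate helps, because
      \<open>four\<close> is uniform in \<open>k\<close> and its bound tends to 0 along every
      subsequence.\<close>
    have "(\<lambda>j. e (Suc (r j))) \<longlonglongrightarrow> 0" using LIMSEQ_subseq_LIMSEQ[OF e_lim r] by (simp add: o_def)
    from order_tendstoD(2)[OF this \<epsilon>] obtain j where "e (Suc (r j)) < \<epsilon>"
      by (auto simp: eventually_sequentially)
    moreover obtain k where "\<epsilon> \<le> norm (fourier (moran_nu N B (r j)) (1 / 2 + of_int k))"
      using pos[of "1 / 2" j] by auto
    ultimately show False using four[of "r j" k] by linarith
  qed
  with md unit weak noncompact unif show ?thesis by blast
qed

end
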